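(* Let $H\in\mathbb{R}^{n\times n}$ be positive semidefinite, $h\in\mathbb{R}^n$, $f(x)=\tfrac12\langle Hx,x\rangle+\langle h,x\rangle$, and let $g:\mathbb{R}^n\to\mathbb{R}\cup\{\infty\}$ be proper, closed and convex. Let $L=\lambda_{\max}(H)$ and $\gamma\in(0,\tfrac1L)$. Then the forward-backward envelope $F_\gamma^{\mathrm{FB}}$ (defined in the context) satisfies $$\tfrac{1}{2\gamma}\|x-y\|_{P-P^2}^2\le F_\gamma^{\mathrm{FB}}(x)-F_\gamma^{\mathrm{FB}}(y)-\langle\nabla F_\gamma^{\mathrm{FB}}(y),x-y\rangle\le\tfrac1{2\gamma}\|x-y\|_P^2$$ for all $x,y\in\mathbb{R}^n$, where $P=\mathrm{Id}-\gamma H$ is positive definite. If in addition $\lambda_{\min}(H)=m>0$, then $P-P^2$ is positive definite and $F_\gamma^{\mathrm{FB}}$ is $\gamma^{-1}$-strongly convex with respect to $\|\cdot\|_{P-P^2}$.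
   Context: $\langle\cdot,\cdot\rangle$ is an inner product on $\mathbb{R}^n$ with induced norm $\|\cdot\|$. For a positive semidefinite operator $Q$ (self-adjoint with nonnegative eigenvalues), $\|x\|_Q^2=\langle Qx,x\rangle$. For positive definite $Q$ and $\sigma>0$, a function $\phi$ is $\sigma$-strongly convex with respect to $\|\cdot\|_Q$ if $\phi-\tfrac\sigma2\|\cdot\|_Q^2$ is convex. The conjugate of $\phi$ is $\phi^*(y)=\sup_x\{\langle y,x\rangle-\phi(x)\}$. For $\gamma>0$ put $r_{\gamma g}(x)=\gamma g(x)+\tfrac12\|x\|^2$; its conjugate $r_{\gamma g}^*$ is differentiable with $\nabla r_{\gamma g}^*=\mathrm{prox}_{\gamma g}$, where $\mathrm{prox}_{\gamma g}(z)=\operatorname{argmin}_x\{g(x)+\tfrac1{2\gamma}\|x-z\|^2\}$. The forward-backward envelope is $$F_\gamma^{\mathrm{FB}}(x)=\gamma^{-1}\Big(\langle x-\gamma\nabla f(x),x\rangle-\big(\tfrac12\|x\|^2-\gamma f(x)\big)-r_{\gamma g}^*\big(x-\gamma\nabla f(x)\big)\Big).$$ If $L=0$, the interval $(0,1/L)$ is read as $(0,\infty)$. *)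

theory Defs
  imports "HOL-Analysis.Analysis"
begin

text \<open>
  Euclidean space with an inner product is an arbitrary type of class \<open>euclidean_space\<close>;
  \<open>n \<times> n\<close> matrices are linear operators on it.  Functions with values in the reals
  extended by infinity are \<open>ereal\<close>-valued.
\<close>

definition eigenvalues :: "('a::real_vector \<Rightarrow> 'a) \<Rightarrow> real set" where
  "eigenvalues Q = {l. \<exists>v. v \<noteq> 0 \<and> Q v = l *\<^sub>R v}"

definition lambda_max :: "('a::real_vector \<Rightarrow> 'a) \<Rightarrow> real" where
  "lambda_max Q = Max (eigenvalues Q)"

definition lambda_min :: "('a::real_vector \<Rightarrow> 'a) \<Rightarrow> real" where
  "lambda_min Q = Min (eigenvalues Q)"

definition self_adjoint :: "('a::real_inner \<Rightarrow> 'a) \<Rightarrow> bool" where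
  "self_adjoint Q \<longleftrightarrow> linear Q \<and> (\<forall>x y. Q x \<bullet> y = x \<bullet> Q y)"

definition pos_semidefinite :: "('a::real_inner \<Rightarrow> 'a) \<Rightarrow> bool" where
  "pos_semidefinite Q \<longleftrightarrow> self_adjoint Q \<and> (\<forall>l\<in>eigenvalues Q. 0 \<le> l)"

definition pos_definite :: "('a::real_inner \<Rightarrow> 'a) \<Rightarrow> bool" where
  "pos_definite Q \<longleftrightarrow> self_adjoint Q \<and> (\<forall>l\<in>eigenvalues Q. 0 < l)"

definition qnorm_sq :: "('a::real_inner \<Rightarrow> 'a) \<Rightarrow> 'a \<Rightarrow> real" where
  "qnorm_sq Q x = Q x \<bullet> x"

definition strongly_convex_wrt ::
    "('a::real_inner \<Rightarrow> 'a) \<Rightarrow> real \<Rightarrow> ('a \<Rightarrow> real) \<Rightarrow> bool" where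
  "strongly_convex_wrt Q \<sigma> \<phi> \<longleftrightarrow>
     convex_on UNIV (\<lambda>x. \<phi> x - \<sigma> / 2 * qnorm_sq Q x)"

text \<open>The library constant \<open>epigraph\<close> covers only real-valued functions.\<close>

definition ereal_epigraph :: "('a \<Rightarrow> ereal) \<Rightarrow> ('a \<times> real) set" where
  "ereal_epigraph g = {(x, t). g x \<le> ereal t}"

definition proper_fun :: "('a \<Rightarrow> ereal) \<Rightarrow> bool" where
  "proper_fun g \<longleftrightarrow> (\<forall>x. g x \<noteq> -\<infinity>) \<and> (\<exists>x. g x \<noteq> \<infinity>)"

definition closed_fun :: "('a::topological_space \<Rightarrow> ereal) \<Rightarrow> bool" where
  "closed_fun g \<longleftrightarrow> closed (ereal_epigraph g)"

definition convex_fun :: "('a::real_vector \<Rightarrow> ereal) \<Rightarrow> bool" where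
  "convex_fun g \<longleftrightarrow> convex (ereal_epigraph g)"

definition conjugate :: "('a::real_inner \<Rightarrow> ereal) \<Rightarrow> 'a \<Rightarrow> ereal" where
  "conjugate \<phi> y = (SUP x. ereal (y \<bullet> x) - \<phi> x)"

text \<open>Meaningful only at points where the function is differentiable.\<close>

definition gradient :: "('a::real_inner \<Rightarrow> real) \<Rightarrow> 'a \<Rightarrow> 'a" where
  "gradient \<phi> x = (THE D. GDERIV \<phi> x :> D)"

definition r_fun :: "real \<Rightarrow> ('a::real_inner \<Rightarrow> ereal) \<Rightarrow> 'a \<Rightarrow> ereal" where
  "r_fun \<gamma> g x = ereal \<gamma> * g x + ereal (1 / 2 * (norm x)\<^sup>2)"

text \<open>
  The envelope is \<open>ereal\<close>-valued because the conjugate is; that it is real-valued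
  has to be stated where its gradient is used.
\<close>

definition fb_envelope ::
    "real \<Rightarrow> ('a::real_inner \<Rightarrow> real) \<Rightarrow> ('a \<Rightarrow> ereal) \<Rightarrow> 'a \<Rightarrow> ereal" where
  "fb_envelope \<gamma> f g x =
     ereal (inverse \<gamma>) *
       (ereal ((x - \<gamma> *\<^sub>R gradient f x) \<bullet> x - (1 / 2 * (norm x)\<^sup>2 - \<gamma> * f x))
        - conjugate (r_fun \<gamma> g) (x - \<gamma> *\<^sub>R gradient f x))"

end

theory Submission
  imports Defs
begin

text \<open>
  Completing the square gives \<open>\<gamma> F(x) = \<langle>P x, x\<rangle> / 2 - R (P x - \<gamma> h)\<close>, where \<open>R\<close> is the conjugate of
  \<open>\<gamma> g + \<parallel>\<cdot>\<parallel>\<^sup>2 / 2\<close>.  This \<open>R\<close> is convex and, because it conjugates a 1-strongly convex function,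
  its Bregman distance from \<open>u\<close> to \<open>v\<close> lies between \<open>0\<close> and \<open>\<parallel>u - v\<parallel>\<^sup>2 / 2\<close>.  The Bregman
  distance of \<open>\<gamma> F\<close> is therefore \<open>\<langle>P d, d\<rangle> / 2\<close>, with \<open>d = x - y\<close>, minus a quantity between
  \<open>0\<close> and \<open>\<parallel>P d\<parallel>\<^sup>2 / 2\<close>.
\<close>

section \<open>Eigenvalues\<close>

text \<open>Eigenvectors for distinct eigenvalues are orthogonal, hence independent, so the
  dimension bounds their number. Finiteness lets \<open>Max\<close> and \<open>Min\<close> in
  \<open>lambda_max\<close> and \<open>lambda_min\<close> bound the eigenvalues.\<close>

lemma finite_eigenvalues:
  fixes Q :: "'a::euclidean_space \<Rightarrow> 'a"
  assumes "self_adjoint Q"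
  shows "finite (eigenvalues Q)"
proof -
  have "\<forall>l\<in>eigenvalues Q. \<exists>v. v \<noteq> 0 \<and> Q v = l *\<^sub>R v"
    by (auto simp: eigenvalues_def)
  then obtain e where e: "\<And>l. l \<in> eigenvalues Q \<Longrightarrow> e l \<noteq> 0 \<and> Q (e l) = l *\<^sub>R e l"
    by metis
  have orth: "e l \<bullet> e k = 0" if "l \<in> eigenvalues Q" "k \<in> eigenvalues Q" "l \<noteq> k" for l k
  proof -
    have "Q (e l) \<bullet> e k = e l \<bullet> Q (e k)"
      using assms by (simp add: self_adjoint_def)
    then have "l * (e l \<bullet> e k) = k * (e l \<bullet> e k)"
      using e that by simp
    then show ?thesis using that by simp
  qed
  have "inj_on e (eigenvalues Q)"
    using orth e by (metis inj_onI inner_eq_zero_iff)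
  moreover have "independent (e ` eigenvalues Q)"
    by (rule pairwise_orthogonal_independent)
      (use orth e in \<open>auto simp: pairwise_def orthogonal_def\<close>)
  ultimately show ?thesis
    using finite_imageD independent_bound by blast
qed

text \<open>For \<open>4 * l \<le> 1\<close> the real polynomial \<open>t - t\<^sup>2 - l\<close> splits, so one of its two linear factors
  already produces an eigenvector; this replaces the spectral theorem.\<close>

lemma eigenvalues_diff_square:
  fixes Q :: "'a::real_vector \<Rightarrow> 'a"
  assumes "linear Q" and l: "l \<in> eigenvalues (\<lambda>z. Q z - Q (Q z))" "4 * l \<le> 1"
  obtains k where "k \<in> eigenvalues Q" "l = k * (1 - k)"
proof -
  obtain v where v: "v \<noteq> 0" "Q v - Q (Q v) = l *\<^sub>R v"
    using l by (auto simp: eigenvalues_def)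
  \<comment> \<open>The larger root of \<open>t * (1 - t) = l\<close>, real because
    \<open>4 * l \<le> 1\<close>; the other root is \<open>1 - k\<close>.\<close>
  define k where "k = (1 + sqrt (1 - 4 * l)) / 2"
  have kl: "l = k * (1 - k)"
  proof -
    have "(sqrt (1 - 4 * l))\<^sup>2 = 1 - 4 * l" using l by simp
    then show ?thesis by (simp add: k_def field_simps power2_eq_square)
  qed
  define w where "w = Q v - k *\<^sub>R v"
  show thesis
  proof (cases "w = 0")
    case True
    with v have "k \<in> eigenvalues Q" by (auto simp: eigenvalues_def w_def)
    with kl that show thesis by blast
  next
    case False
    have "Q (Q v) = Q v - (k * (1 - k)) *\<^sub>R v"
      using v kl by (metis diff_diff_eq2 add_diff_cancel_left')
    then have "Q w = (1 - k) *\<^sub>R w"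
      using \<open>linear Q\<close> by (simp add: w_def linear_diff linear_scale algebra_simps)
    with False have "1 - k \<in> eigenvalues Q" by (auto simp: eigenvalues_def)
    with kl that[of "1 - k"] show thesis by (simp add: mult.commute)
  qed
qed

section \<open>Calculus and quadratic forms\<close>

lemma linear_quadratic_form_bounded:
  fixes Q :: "'a::euclidean_space \<Rightarrow> 'a"
  assumes "linear Q"
  obtains K where "\<And>x. \<bar>Q x \<bullet> x\<bar> \<le> K * (norm x)\<^sup>2"
proof -
  from linear_bounded[OF assms] obtain K where K: "\<And>x. norm (Q x) \<le> K * norm x" by blast
  have "\<bar>Q x \<bullet> x\<bar> \<le> K * (norm x)\<^sup>2" for x
    using Cauchy_Schwarz_ineq2[of "Q x" x] mult_right_mono[OF K[of x] norm_ge_zero[of x]]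
    by (simp add: power2_eq_square mult.assoc)
  then show thesis by (rule that)
qed

text \<open>Divided by \<open>norm (x - y)\<close>, the remainder is at most
  \<open>K * norm (x - y)\<close>, which tends to 0. Two-sided Bregman bounds thus give
  differentiability and the gradient at once.\<close>

lemma gderiv_quadratic_remainder:
  fixes F :: "'a::real_inner \<Rightarrow> real"
  assumes "\<And>x. \<bar>F x - F y - D \<bullet> (x - y)\<bar> \<le> K * (norm (x - y))\<^sup>2"
  shows "GDERIV F y :> D"
proof -
  have "((\<lambda>x. norm (F x - F y - (x - y) \<bullet> D) / norm (x - y)) \<longlongrightarrow> 0) (at y)"
  proof (rule Lim_null_comparison)
    show "\<forall>\<^sub>F x in at y. norm (norm (F x - F y - (x - y) \<bullet> D) / norm (x - y)) \<le> K * norm (x - y)"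
      unfolding eventually_at_filter
      using assms by (auto intro!: always_eventually
          simp: divide_le_eq power2_eq_square mult.assoc inner_commute)
    show "((\<lambda>x. K * norm (x - y)) \<longlongrightarrow> 0) (at y)"
      by (auto intro!: tendsto_eq_intros)
  qed
  then show ?thesis
    unfolding gderiv_def has_derivative_iff_norm
    by (simp add: bounded_linear_inner_left)
qed

lemma gradient_eqI: "GDERIV \<phi> x :> D \<Longrightarrow> gradient \<phi> x = D"
  unfolding gradient_def
proof (rule the_equality)
  fix E assume D: "GDERIV \<phi> x :> D" and E: "GDERIV \<phi> x :> E"
  have "(\<lambda>h. h \<bullet> D) = (\<lambda>h. h \<bullet> E)"
    using D E unfolding gderiv_def by (rule has_derivative_unique)
  then show "E = D" by (metis vector_eq_ldot)
qed

text \<open>The minorant touching at a point \<open>z\<close> of the segment suffices: in the convex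
  combination of its values at \<open>x\<close> and \<open>y\<close> the slope terms cancel.\<close>

lemma convex_on_if_affine_minorants:
  fixes \<phi> :: "'a::real_inner \<Rightarrow> real"
  assumes "\<And>x y. \<phi> y + D y \<bullet> (x - y) \<le> \<phi> x"
  shows "convex_on UNIV \<phi>"
proof (rule convex_onI)
  fix t :: real and x y :: 'a assume t: "0 < t" "t < 1"
  define z where "z = (1 - t) *\<^sub>R x + t *\<^sub>R y"
  have "(1 - t) * (\<phi> z + D z \<bullet> (x - z)) + t * (\<phi> z + D z \<bullet> (y - z)) \<le> (1 - t) * \<phi> x + t * \<phi> y"
    using t assms by (intro add_mono mult_left_mono) auto
  moreover have "(1 - t) * (\<phi> z + D z \<bullet> (x - z)) + t * (\<phi> z + D z \<bullet> (y - z)) = \<phi> z"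
    by (simp add: z_def algebra_simps)
  ultimately show "\<phi> ((1 - t) *\<^sub>R x + t *\<^sub>R y) \<le> (1 - t) * \<phi> x + t * \<phi> y"
    by (simp add: z_def)
qed simp

lemma self_adjoint_qnorm_sq_diff:
  assumes "self_adjoint Q"
  shows "qnorm_sq Q (x - y) = qnorm_sq Q x - qnorm_sq Q y - (2 *\<^sub>R Q y) \<bullet> (x - y)"
proof -
  have "Q x \<bullet> y = Q y \<bullet> x"
    using assms by (metis inner_commute self_adjoint_def)
  with assms show ?thesis
    by (simp add: self_adjoint_def qnorm_sq_def linear_diff algebra_simps)
qed

section \<open>Proximal points and the conjugate of \<open>r_fun\<close>\<close>

text \<open>Separate the epigraph from a point strictly below the graph, vertically over the domain:
  the separating hyperplane is then not vertical.\<close>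

lemma convex_fun_affine_minorant:
  fixes g :: "'a::euclidean_space \<Rightarrow> ereal"
  assumes g: "proper_fun g" "closed_fun g" "convex_fun g"
  obtains a b where "\<And>x t. g x \<le> ereal t \<Longrightarrow> a \<bullet> x + b \<le> t"
proof -
  obtain x0 t0 where x0: "g x0 = ereal t0"
    using g(1) unfolding proper_fun_def by (metis ereal_cases)
  have "(x0, t0 - 1) \<notin> ereal_epigraph g"
    by (simp add: ereal_epigraph_def x0)
  then obtain n c where sep: "n \<bullet> (x0, t0 - 1) < c" "\<forall>p\<in>ereal_epigraph g. n \<bullet> p > c"
    using separating_hyperplane_closed_point[of "ereal_epigraph g" "(x0, t0 - 1)"] g
    unfolding closed_fun_def convex_fun_def by blast
  obtain u r where n: "n = (u, r)" by (cases n)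
  have sep2: "c < u \<bullet> x + r * t" if "g x \<le> ereal t" for x t
    using sep(2) that by (auto simp: n ereal_epigraph_def)
  have "r > 0"
    using sep(1) sep2[of x0 t0] x0 by (simp add: n algebra_simps)
  then have "(- (1 / r) *\<^sub>R u) \<bullet> x + c / r \<le> t" if "g x \<le> ereal t" for x t
    using sep2[OF that] by (simp add: field_simps)
  then show thesis by (rule that)
qed

text \<open>The inequality below is the subgradient inequality characterising \<open>p\<close> as the proximal
  point of \<open>z\<close>; taken at \<open>x = p\<close> it forces \<open>s = g p\<close>.\<close>

lemma proximal_point_exists:
  fixes g :: "'a::euclidean_space \<Rightarrow> ereal"
  assumes g: "proper_fun g" "closed_fun g" "convex_fun g" and \<gamma>: "0 < \<gamma>"
  shows "\<exists>p s. g p \<le> ereal s \<and>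
    (\<forall>x t. g x \<le> ereal t \<longrightarrow> (z - p) \<bullet> (x - p) \<le> \<gamma> * (t - s))"
proof -
  define E where "E = ereal_epigraph g"
  have E: "(x, t) \<in> E \<longleftrightarrow> g x \<le> ereal t" for x t
    by (simp add: E_def ereal_epigraph_def)
  \<comment> \<open>Up to the constant \<open>(norm z)\<^sup>2 / 2\<close> this is
    \<open>\<gamma>\<close> times the proximal objective, read on the epigraph, whose closedness
    stands in for lower semicontinuity of \<open>g\<close>.\<close>
  define \<phi> where "\<phi> = (\<lambda>q::'a \<times> real. \<gamma> * snd q + (norm (fst q))\<^sup>2 / 2 - z \<bullet> fst q)"
  obtain a b where ab: "\<And>x t. g x \<le> ereal t \<Longrightarrow> a \<bullet> x + b \<le> t"
    using convex_fun_affine_minorant[OF g] by blast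
  obtain x0 t0 where x0: "g x0 = ereal t0"
    using g(1) unfolding proper_fun_def by (metis ereal_cases)
  define S where "S = E \<inter> {q. \<phi> q \<le> \<phi> (x0, t0)}"
  have cont: "continuous_on A \<phi>" for A
    unfolding \<phi>_def by (intro continuous_intros) simp
  have "closed S"
    unfolding S_def using g(2)
    by (intro closed_Int closed_Collect_le cont continuous_intros) (simp add: E_def closed_fun_def)
  \<comment> \<open>Inserting the affine minorant into \<open>\<phi> q \<le> M\<close> and
    completing the square puts \<open>x\<close> in the ball of radius \<open>\<rho>\<close> around
    \<open>w\<close>; \<open>B\<close> is the resulting bound on \<open>norm x\<close>.\<close>
  define w where "w = z - \<gamma> *\<^sub>R a"
  define M where "M = \<phi> (x0, t0)"
  define \<rho> where "\<rho> = sqrt (2 * (M - \<gamma> * b) + (norm w)\<^sup>2)"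
  define B where "B = norm w + \<rho>"
  have "\<bar>t\<bar> \<le> \<bar>norm a * B\<bar> + \<bar>b\<bar> + (\<bar>M\<bar> + norm z * B) / \<gamma> \<and> norm x \<le> B"
    if "(x, t) \<in> S" for x t
  proof -
    have t: "a \<bullet> x + b \<le> t" and M: "\<gamma> * t + (norm x)\<^sup>2 / 2 - z \<bullet> x \<le> M"
      using that ab by (auto simp: S_def E \<phi>_def M_def)
    have "\<gamma> * (a \<bullet> x + b) \<le> \<gamma> * t" using t \<gamma> by simp
    with M have "(norm (x - w))\<^sup>2 \<le> 2 * (M - \<gamma> * b) + (norm w)\<^sup>2"
      by (simp add: w_def power2_norm_eq_inner algebra_simps inner_commute)
    then have "norm (x - w) \<le> \<rho>"
      unfolding \<rho>_def by (rule real_le_rsqrt)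
    then have xB: "norm x \<le> B"
      unfolding B_def using norm_triangle_sub[of x w] by linarith
    have "\<bar>a \<bullet> x\<bar> \<le> norm a * B" "\<bar>z \<bullet> x\<bar> \<le> norm z * B"
      using Cauchy_Schwarz_ineq2 xB by (meson mult_left_mono norm_ge_zero order_trans)+
    moreover from this M have "\<gamma> * t \<le> \<bar>M\<bar> + norm z * B"
      using zero_le_power2[of "norm x"] by linarith
    then have "t \<le> (\<bar>M\<bar> + norm z * B) / \<gamma>"
      using \<gamma> by (simp add: field_simps)
    moreover have "0 \<le> (\<bar>M\<bar> + norm z * B) / \<gamma>"
      using \<gamma> order_trans[OF norm_ge_zero xB] by simp
    ultimately show ?thesis using t xB by linarith
  qed
  then have "S \<subseteq> cball 0 B \<times> cball 0 (\<bar>norm a * B\<bar> + \<bar>b\<bar> + (\<bar>M\<bar> + norm z * B) / \<gamma>)"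
    by auto
  then have "bounded S"
    by (rule bounded_subset[rotated]) (intro bounded_Times bounded_cball)
  with \<open>closed S\<close> have "compact S" by (simp add: compact_eq_bounded_closed)
  moreover have "(x0, t0) \<in> S" by (simp add: S_def E x0)
  ultimately obtain q where q: "q \<in> S" "\<forall>q'\<in>S. \<phi> q \<le> \<phi> q'"
    using continuous_attains_inf[OF _ _ cont] by blast
  obtain p s where ps: "q = (p, s)" by (cases q)
  have psE: "(p, s) \<in> E" using q ps by (simp add: S_def)
  have min: "\<phi> (p, s) \<le> \<phi> q'" if "q' \<in> E" for q'
    using q that \<open>(x0, t0) \<in> S\<close> ps by (fastforce simp: S_def)
  have "(z - p) \<bullet> (x - p) \<le> \<gamma> * (t - s)" if "g x \<le> ereal t" for x t
  proof -
    \<comment> \<open>First variation: convexity keeps the segment from \<open>(p, s)\<close> to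
      \<open>(x, t)\<close> in \<open>E\<close>. Minimality divided by the step \<open>l\<close>
      leaves an error of order \<open>l\<close>, which vanishes in the limit.\<close>
    have *: "(z - p) \<bullet> (x - p) - \<gamma> * (t - s) \<le> l * ((norm (x - p))\<^sup>2 / 2)" if l: "0 < l" "l \<le> 1" for l
    proof -
      have "(1 - l) *\<^sub>R (p, s) + l *\<^sub>R (x, t) \<in> E"
        using g(3) psE \<open>g x \<le> ereal t\<close> l unfolding convex_fun_def E_def[symmetric]
        by (intro convexD) (auto simp: E)
      moreover have "\<phi> ((1 - l) *\<^sub>R (p, s) + l *\<^sub>R (x, t)) = \<phi> (p, s)
          - l * ((z - p) \<bullet> (x - p) - \<gamma> * (t - s)) + l * (l * ((norm (x - p))\<^sup>2 / 2))"
        by (simp add: \<phi>_def power2_norm_eq_inner inner_commute inner_diff_left inner_diff_right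
            inner_add_left inner_add_right field_simps)
      ultimately have "l * ((z - p) \<bullet> (x - p) - \<gamma> * (t - s)) \<le> l * (l * ((norm (x - p))\<^sup>2 / 2))"
        using min by fastforce
      with l show ?thesis by simp
    qed
    have "((\<lambda>l. l * ((norm (x - p))\<^sup>2 / 2)) \<longlongrightarrow> 0) (at_right 0)"
      by (auto intro!: tendsto_eq_intros)
    moreover have "\<forall>\<^sub>F l in at_right 0. (z - p) \<bullet> (x - p) - \<gamma> * (t - s) \<le> l * ((norm (x - p))\<^sup>2 / 2)"
      using * eventually_at_right_less[of "0::real"]
      by (auto simp: eventually_at_right_field intro!: exI[of _ 1])
    ultimately have "(z - p) \<bullet> (x - p) - \<gamma> * (t - s) \<le> 0"
      using tendsto_lowerbound by fastforce
    then show ?thesis by simp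
  qed
  then show ?thesis using psE E by blast
qed

text \<open>A maximiser over the real epigraph determines the extended-valued supremum: where
  \<open>g\<close> is \<open>\<infinity>\<close> the contribution is \<open>-\<infinity>\<close>,
  and properness excludes the value \<open>-\<infinity>\<close> of \<open>g\<close>.\<close>

lemma conjugate_r_fun_eqI:
  assumes g: "proper_fun g" and \<gamma>: "0 < \<gamma>" and p: "g p \<le> ereal s"
    and val: "c = u \<bullet> p - \<gamma> * s - (norm p)\<^sup>2 / 2"
    and max: "\<And>x t. g x \<le> ereal t \<Longrightarrow> u \<bullet> x - \<gamma> * t - (norm x)\<^sup>2 / 2 \<le> c"
  shows "conjugate (r_fun \<gamma> g) u = ereal c"
  unfolding conjugate_def
proof (rule antisym)
  show "(SUP x. ereal (u \<bullet> x) - r_fun \<gamma> g x) \<le> ereal c"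
  proof (rule SUP_least)
    fix x show "ereal (u \<bullet> x) - r_fun \<gamma> g x \<le> ereal c"
    proof (cases "g x")
      case (real t)
      with max[of x t] show ?thesis by (simp add: r_fun_def)
    next
      case PInf
      with \<gamma> show ?thesis by (simp add: r_fun_def)
    next
      case MInf
      with g show ?thesis by (simp add: proper_fun_def)
    qed
  qed
  obtain t where t: "g p = ereal t" "t \<le> s"
    using g p unfolding proper_fun_def by (cases "g p") auto
  have "ereal c \<le> ereal (u \<bullet> p) - r_fun \<gamma> g p"
    using t \<gamma> by (simp add: val r_fun_def)
  also have "\<dots> \<le> (SUP x. ereal (u \<bullet> x) - r_fun \<gamma> g x)"
    by (rule SUP_upper) simp
  finally show "ereal c \<le> (SUP x. ereal (u \<bullet> x) - r_fun \<gamma> g x)" .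
qed

text \<open>Here \<open>p\<close> is the proximal map. Since \<open>p v\<close> attains the supremum
  defining the conjugate at \<open>v\<close>, it is a subgradient of \<open>R\<close> there; the
  upper bound is the smoothness dual to strong convexity of \<open>r_fun \<gamma> g\<close>.\<close>

lemma conjugate_r_fun_smooth:
  fixes g :: "'a::euclidean_space \<Rightarrow> ereal"
  assumes g: "proper_fun g" "closed_fun g" "convex_fun g" and \<gamma>: "0 < \<gamma>"
  obtains R p where
    "\<And>u. conjugate (r_fun \<gamma> g) u = ereal (R u)"
    "\<And>u v. 0 \<le> R u - R v - p v \<bullet> (u - v)"
    "\<And>u v. R u - R v - p v \<bullet> (u - v) \<le> (norm (u - v))\<^sup>2 / 2"
proof -
  from proximal_point_exists[OF g \<gamma>] obtain p s where
    ps: "\<And>z. g (p z) \<le> ereal (s z)" and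
    opt: "\<And>z x t. g x \<le> ereal t \<Longrightarrow> (z - p z) \<bullet> (x - p z) \<le> \<gamma> * (t - s z)"
    by metis
  define R where "R u = u \<bullet> p u - \<gamma> * s u - (norm (p u))\<^sup>2 / 2" for u
  have upper: "u \<bullet> x - \<gamma> * t - (norm x)\<^sup>2 / 2 \<le> R v + p v \<bullet> (u - v) + (norm (u - v))\<^sup>2 / 2"
    if "g x \<le> ereal t" for u v x t
  proof -
    \<comment> \<open>The gap is the slack in the proximal inequality plus half a perfect
      square.\<close>
    have "R v + p v \<bullet> (u - v) + (norm (u - v))\<^sup>2 / 2 - (u \<bullet> x - \<gamma> * t - (norm x)\<^sup>2 / 2)
        = (\<gamma> * (t - s v) - (v - p v) \<bullet> (x - p v)) + (norm ((u - v) - (x - p v)))\<^sup>2 / 2"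
      by (simp add: R_def power2_norm_eq_inner inner_commute inner_diff_left inner_diff_right
          inner_add_left inner_add_right field_simps)
    moreover have "0 \<le> (norm ((u - v) - (x - p v)))\<^sup>2 / 2" by simp
    ultimately show ?thesis using opt[OF that, of v] by linarith
  qed
  have max: "u \<bullet> x - \<gamma> * t - (norm x)\<^sup>2 / 2 \<le> R u" if "g x \<le> ereal t" for u x t
    using upper[OF that, of u u] by simp
  show thesis
  proof
    show "conjugate (r_fun \<gamma> g) u = ereal (R u)" for u
      by (rule conjugate_r_fun_eqI[OF g(1) \<gamma> ps R_def max])
    show "0 \<le> R u - R v - p v \<bullet> (u - v)" for u v
      using max[OF ps, of u v] by (simp add: R_def algebra_simps inner_commute)
    show "R u - R v - p v \<bullet> (u - v) \<le> (norm (u - v))\<^sup>2 / 2" for u v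
      using upper[OF ps, of u u v] by (simp add: R_def)
  qed
qed

section \<open>The envelope for quadratic \<open>f\<close>\<close>

theorem proposition4p3:
  fixes H P :: "'a::euclidean_space \<Rightarrow> 'a"
    and h :: 'a
    and f :: "'a \<Rightarrow> real"
    and g :: "'a \<Rightarrow> ereal"
    and L \<gamma> :: real
  assumes H: "pos_semidefinite H"
    and f: "f = (\<lambda>x. 1 / 2 * (H x \<bullet> x) + h \<bullet> x)"
    and g: "proper_fun g" "closed_fun g" "convex_fun g"
    and L: "L = lambda_max H"
    and \<gamma>: "0 < \<gamma>" "L = 0 \<or> \<gamma> < 1 / L"
    and P: "P = (\<lambda>x. x - \<gamma> *\<^sub>R H x)"
  shows "pos_definite P \<and>
    (\<exists>F :: 'a \<Rightarrow> real.
       (\<forall>x. fb_envelope \<gamma> f g x = ereal (F x)) \<and>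
       (\<forall>x. F differentiable (at x)) \<and>
       (\<forall>x y.
          1 / (2 * \<gamma>) * qnorm_sq (\<lambda>z. P z - P (P z)) (x - y)
            \<le> F x - F y - gradient F y \<bullet> (x - y) \<and>
          F x - F y - gradient F y \<bullet> (x - y)
            \<le> 1 / (2 * \<gamma>) * qnorm_sq P (x - y)) \<and>
       (\<forall>m. lambda_min H = m \<and> m > 0 \<longrightarrow>
          pos_definite (\<lambda>z. P z - P (P z)) \<and>
          strongly_convex_wrt (\<lambda>z. P z - P (P z)) (inverse \<gamma>) F))"
proof -
  have saH: "self_adjoint H" using H by (simp add: pos_semidefinite_def)
  then have linH: "linear H" and symH: "\<And>x y. H x \<bullet> y = x \<bullet> H y"
    by (auto simp: self_adjoint_def)
  have linP: "linear P"
    unfolding P using linH by (intro linear_compose_sub linear_id[unfolded id_def] linear_compose_scale_right)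
  have symP: "P x \<bullet> y = x \<bullet> P y" for x y
    by (simp add: P inner_diff_left inner_diff_right symH)
  have saP: "self_adjoint P" using linP symP by (simp add: self_adjoint_def)
  have eigP: "(1 - l) / \<gamma> \<in> eigenvalues H" if l: "l \<in> eigenvalues P" for l
  proof -
    obtain v where v: "v \<noteq> 0" "P v = l *\<^sub>R v" using l by (auto simp: eigenvalues_def)
    have "\<gamma> *\<^sub>R H v = (1 - l) *\<^sub>R v"
      using v(2) by (simp add: P algebra_simps)
    then have "(1 / \<gamma>) *\<^sub>R (\<gamma> *\<^sub>R H v) = (1 / \<gamma>) *\<^sub>R ((1 - l) *\<^sub>R v)" by simp
    then have "H v = ((1 - l) / \<gamma>) *\<^sub>R v" using \<gamma>(1) by simp
    with v show ?thesis by (auto simp: eigenvalues_def)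
  qed
  have posP: "0 < l" if l: "l \<in> eigenvalues P" for l
  proof -
    have le: "(1 - l) / \<gamma> \<le> L"
      unfolding L lambda_max_def by (intro Max_ge finite_eigenvalues saH eigP l)
    have "0 \<le> (1 - l) / \<gamma>"
      using H eigP[OF l] by (simp add: pos_semidefinite_def)
    \<comment> \<open>Nonnegativity of \<open>L\<close> comes from the eigenvalue of
      \<open>H\<close> at hand, squeezed between \<open>0\<close> and \<open>L\<close>.\<close>
    with le have "0 \<le> L" by linarith
    with \<gamma> have "\<gamma> * L < 1" by (cases "L = 0") (auto simp: pos_less_divide_eq)
    with le \<gamma>(1) show ?thesis by (simp add: field_simps)
  qed
  have pdP: "pos_definite P"
    using saP posP by (simp add: pos_definite_def)

  have gradf: "gradient f x = H x + h" for x
  proof -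
    obtain K where K: "\<And>x. \<bar>H x \<bullet> x\<bar> \<le> K * (norm x)\<^sup>2"
      using linear_quadratic_form_bounded[OF linH] by blast
    have "f y - f x - (H x + h) \<bullet> (y - x) = 1 / 2 * (H (y - x) \<bullet> (y - x))" for y
      using symH[of x y]
      by (simp add: f linear_diff[OF linH] algebra_simps inner_commute)
    with K have "\<bar>f y - f x - (H x + h) \<bullet> (y - x)\<bar> \<le> (K / 2) * (norm (y - x))\<^sup>2" for y
      by (simp only: abs_mult) simp
    then show ?thesis by (intro gradient_eqI gderiv_quadratic_remainder)
  qed
  obtain R p where R: "\<And>u. conjugate (r_fun \<gamma> g) u = ereal (R u)"
    "\<And>u v. 0 \<le> R u - R v - p v \<bullet> (u - v)"
    "\<And>u v. R u - R v - p v \<bullet> (u - v) \<le> (norm (u - v))\<^sup>2 / 2"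
    using conjugate_r_fun_smooth[OF g \<gamma>(1)] by blast
  \<comment> \<open>\<open>T\<close> is the forward step; \<open>D\<close> below is the chain-rule
    candidate for the gradient of \<open>F\<close>, with \<open>p\<close> as gradient of
    \<open>R\<close> and the self-adjoint \<open>P\<close> as derivative of
    \<open>T\<close>.\<close>
  define T where "T x = P x - \<gamma> *\<^sub>R h" for x
  define F where "F x = inverse \<gamma> * (1 / 2 * (P x \<bullet> x) - R (T x))" for x
  define D where "D y = inverse \<gamma> *\<^sub>R (P y - P (p (T y)))" for y
  have envelope: "fb_envelope \<gamma> f g x = ereal (F x)" for x
  proof -
    have "x - \<gamma> *\<^sub>R gradient f x = T x"
      by (simp add: gradf T_def P algebra_simps)
    \<comment> \<open>The \<open>h\<close> terms cancel, and
      \<open>(norm x)\<^sup>2 - \<gamma> * (H x \<bullet> x)\<close> is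
      \<open>P x \<bullet> x\<close>.\<close>
    moreover have "T x \<bullet> x - (1 / 2 * (norm x)\<^sup>2 - \<gamma> * f x) = 1 / 2 * (P x \<bullet> x)"
      by (simp add: T_def P f power2_norm_eq_inner algebra_simps)
    ultimately show ?thesis
      by (simp add: fb_envelope_def R F_def)
  qed

  have bregman: "F x - F y - D y \<bullet> (x - y) =
      inverse \<gamma> * (1 / 2 * qnorm_sq P (x - y) - (R (T x) - R (T y) - p (T y) \<bullet> (T x - T y)))" for x y
  proof -
    have R_part: "p (T y) \<bullet> (T x - T y) = P (p (T y)) \<bullet> (x - y)"
      by (simp add: T_def symP linear_diff[OF linP])
    have P_part: "qnorm_sq P (x - y) = P x \<bullet> x - P y \<bullet> y - 2 * (P y \<bullet> (x - y))"
      using self_adjoint_qnorm_sq_diff[OF saP, of x y] by (simp add: qnorm_sq_def)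
    show ?thesis
      unfolding R_part P_part by (simp add: F_def D_def algebra_simps)
  qed
  have upper: "F x - F y - D y \<bullet> (x - y) \<le> 1 / (2 * \<gamma>) * qnorm_sq P (x - y)" for x y
  proof -
    have "F x - F y - D y \<bullet> (x - y) \<le> inverse \<gamma> * (1 / 2 * qnorm_sq P (x - y))"
      unfolding bregman using \<gamma>(1) R(2)[of "T x" "T y"] by (intro mult_left_mono) auto
    then show ?thesis by (simp add: field_simps)
  qed
  have qn: "qnorm_sq (\<lambda>z. P z - P (P z)) d = qnorm_sq P d - (norm (P d))\<^sup>2" for d
    by (simp add: qnorm_sq_def inner_diff_left symP power2_norm_eq_inner)
  have lower: "1 / (2 * \<gamma>) * qnorm_sq (\<lambda>z. P z - P (P z)) (x - y) \<le> F x - F y - D y \<bullet> (x - y)" for x y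
  proof -
    have "T x - T y = P (x - y)" by (simp add: T_def linear_diff[OF linP])
    then have "inverse \<gamma> * (1 / 2 * (qnorm_sq P (x - y) - (norm (P (x - y)))\<^sup>2)) \<le>
        F x - F y - D y \<bullet> (x - y)"
      unfolding bregman using \<gamma>(1) R(3)[of "T x" "T y"] by (intro mult_left_mono) auto
    then show ?thesis unfolding qn by (simp add: field_simps)
  qed
  let ?Q = "\<lambda>z. P z - P (P z)"
  have linQ: "linear ?Q"
    using linear_compose[OF linP linP] linP by (intro linear_compose_sub) (simp_all add: o_def)
  have saQ: "self_adjoint ?Q"
    using linQ symP by (simp add: self_adjoint_def inner_diff_left inner_diff_right)
  \<comment> \<open>The bounds hold for the candidate \<open>D\<close> and trap the remainder
    between two quadratic forms, which makes \<open>D\<close> the gradient after the fact.\<close>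
  have derivF: "GDERIV F y :> D y" for y
  proof -
    obtain K where K: "\<And>x. \<bar>P x \<bullet> x\<bar> \<le> K * (norm x)\<^sup>2"
      using linear_quadratic_form_bounded[OF linP] by blast
    obtain K' where K': "\<And>x. \<bar>?Q x \<bullet> x\<bar> \<le> K' * (norm x)\<^sup>2"
      using linear_quadratic_form_bounded[OF linQ] by blast
    have "\<bar>F x - F y - D y \<bullet> (x - y)\<bar> \<le> (1 / (2 * \<gamma>) * (K + K')) * (norm (x - y))\<^sup>2" for x
    proof -
      have "\<bar>F x - F y - D y \<bullet> (x - y)\<bar> \<le>
          \<bar>1 / (2 * \<gamma>) * qnorm_sq P (x - y)\<bar> + \<bar>1 / (2 * \<gamma>) * qnorm_sq ?Q (x - y)\<bar>"
        using lower[of x y] upper[of x y] by linarith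
      also have "\<dots> = 1 / (2 * \<gamma>) * \<bar>qnorm_sq P (x - y)\<bar> + 1 / (2 * \<gamma>) * \<bar>qnorm_sq ?Q (x - y)\<bar>"
        using \<gamma>(1) by (simp add: abs_mult)
      also have "\<dots> \<le> 1 / (2 * \<gamma>) * (K * (norm (x - y))\<^sup>2) + 1 / (2 * \<gamma>) * (K' * (norm (x - y))\<^sup>2)"
        unfolding qnorm_sq_def using K K' \<gamma>(1) by (intro add_mono mult_left_mono) auto
      finally show ?thesis by (simp add: algebra_simps add_divide_distrib)
    qed
    then show ?thesis by (rule gderiv_quadratic_remainder)
  qed
  have diffF: "F differentiable (at x)" for x
    using derivF[of x] unfolding gderiv_def differentiable_def by blast
  have gradF: "gradient F y = D y" for y
    using derivF by (rule gradient_eqI)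
  have scF: "strongly_convex_wrt ?Q (inverse \<gamma>) F"
    unfolding strongly_convex_wrt_def
  \<comment> \<open>The slope is the gradient of \<open>F\<close> minus that of the quadratic term,
    which turns \<open>lower\<close> into the affine minorant inequality.\<close>
  proof (rule convex_on_if_affine_minorants[where D = "\<lambda>y. D y - inverse \<gamma> *\<^sub>R ?Q y"])
    fix x y
    show "F y - inverse \<gamma> / 2 * qnorm_sq ?Q y + (D y - inverse \<gamma> *\<^sub>R ?Q y) \<bullet> (x - y)
      \<le> F x - inverse \<gamma> / 2 * qnorm_sq ?Q x"
    proof -
      have "1 / (2 * \<gamma>) = inverse \<gamma> / 2" by (simp add: field_simps)
      then have "inverse \<gamma> / 2 * (qnorm_sq ?Q x - qnorm_sq ?Q y - 2 * (?Q y \<bullet> (x - y)))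
          \<le> F x - F y - D y \<bullet> (x - y)"
        using lower[of x y] by (simp only: self_adjoint_qnorm_sq_diff[OF saQ, of x y] inner_scaleR_left)
      moreover have "(D y - inverse \<gamma> *\<^sub>R ?Q y) \<bullet> (x - y) =
          D y \<bullet> (x - y) - inverse \<gamma> * (?Q y \<bullet> (x - y))"
        by (simp only: inner_diff_left[of "D y"] inner_scaleR_left)
      moreover have "b - i / 2 * q + (d - i * r) \<le> a - i / 2 * q'"
        if "i / 2 * (q' - q - 2 * r) \<le> a - b - d" for a b d i q q' r :: real
        using that by (simp add: algebra_simps)
      ultimately show ?thesis by presburger
    qed
  qed
  have pdQ: "pos_definite ?Q" if "lambda_min H = m \<and> m > 0" for m
    unfolding pos_definite_def
  proof (intro conjI saQ ballI)
    fix l assume l: "l \<in> eigenvalues ?Q"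
    show "0 < l"
    \<comment> \<open>Above \<open>1 / 4\<close> positivity is trivial. Otherwise
      \<open>l = k * (1 - k)\<close> with \<open>k\<close> an eigenvalue of \<open>P\<close>:
      \<open>k > 0\<close> by \<open>posP\<close>, and \<open>k < 1\<close> because
      \<open>m > 0\<close> bounds \<open>(1 - k) / \<gamma>\<close> from below.\<close>
    proof (cases "4 * l \<le> 1")
      case True
      then obtain k where k: "k \<in> eigenvalues P" "l = k * (1 - k)"
        using eigenvalues_diff_square[OF linP l] by blast
      have "m \<le> (1 - k) / \<gamma>"
        using that Min_le[OF finite_eigenvalues[OF saH] eigP[OF k(1)]] by (simp add: lambda_min_def)
      with that \<gamma>(1) have "0 < 1 - k"
        by (smt (verit) divide_nonpos_pos)
      with k posP show ?thesis by simp
    qed simp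
  qed
  show ?thesis
    by (intro conjI exI[of _ F] allI impI)
      (use pdP envelope diffF lower upper pdQ scF in \<open>simp_all add: gradF\<close>)
qed

end
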